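(* Let $X,Y\in\mathcal M_{mn}$. (i) If $X\in P$, then $D_X^J\leq D_Y^J$ if and only if $\operatorname{rank}(X)\leq\operatorname{rank}(JYJ)$. (ii) If $Y\in P$, then $D_X^J\leq D_Y^J$ if and only if $\operatorname{rank}(X)\leq\operatorname{rank}(Y)$. The regular $\mathcal D^J$-classes of $\mathcal M_{mn}^J$ form a chain $D_0^J<\cdots<D_r^J$, where $D_s^J=\{X\in P:\operatorname{rank}(X)=s\}$ for each $0\leq s\leq r$.
   Context: Let $\mathbb F$ be a field, $m,n\geq1$ integers, and $0\leq r\leq\min(m,n)$. $\mathcal M_{kl}$ denotes the set of all $k\times l$ matrices over $\mathbb F$. Let $J=\begin{bmatrix}I_r&O\\O&O\end{bmatrix}\in\mathcal M_{nm}$ (an $n\times m$ matrix), and let $\mathcal M_{mn}^J$ be the semigroup with underlying set $\mathcal M_{mn}$ and operation $X\star Y=XJY$. $P=\operatorname{Reg}(\mathcal M_{mn}^J)$ is the set of all regular elements of $\mathcal M_{mn}^J$ (those $X$ with $X=X\star Y\star X$ for some $Y$); equivalently $P=\{X\in\mathcal M_{mn}:\operatorname{rank}(JXJ)=\operatorname{rank}(X)\}$. $\mathcal D^J$ and $\mathcal J^J$ are the usual Green's relations of $\mathcal M_{mn}^J$ (in this semigroup $\mathcal D^J=\mathcal J^J$), and $D_X^J$ is the $\mathcal D^J$-class of $X$. A $\mathcal D^J$-class is regular if its elements are regular. The partial order on $\mathcal D^J=\mathcal J^J$-classes is the usual one: $D_X^J\leq D_Y^J$ iff $X=Y$, or $X=U\star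 Y$, or $X=Y\star V$, or $X=U\star Y\star V$ for some $U,V\in\mathcal M_{mn}$. *)

theory Defs
  imports "Jordan_Normal_Form.DL_Rank"
begin

text \<open>A semigroup is given by a carrier set \<open>S\<close> and an operation \<open>f\<close>.
  The ideals below are the principal ones generated by an element \<open>x\<close> after an identity
  has been adjoined; the adjoined identity contributes \<open>x\<close> itself.\<close>

definition principal_left_ideal :: "'a set \<Rightarrow> ('a \<Rightarrow> 'a \<Rightarrow> 'a) \<Rightarrow> 'a \<Rightarrow> 'a set" where
  "principal_left_ideal S f x = insert x {f u x | u. u \<in> S}"

definition principal_right_ideal :: "'a set \<Rightarrow> ('a \<Rightarrow> 'a \<Rightarrow> 'a) \<Rightarrow> 'a \<Rightarrow> 'a set" where
  "principal_right_ideal S f x = insert x {f x v | v. v \<in> S}"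

definition principal_ideal :: "'a set \<Rightarrow> ('a \<Rightarrow> 'a \<Rightarrow> 'a) \<Rightarrow> 'a \<Rightarrow> 'a set" where
  "principal_ideal S f x =
     insert x ({f u x | u. u \<in> S} \<union> {f x v | v. v \<in> S} \<union> {f (f u x) v | u v. u \<in> S \<and> v \<in> S})"

definition green_L :: "'a set \<Rightarrow> ('a \<Rightarrow> 'a \<Rightarrow> 'a) \<Rightarrow> 'a rel" where
  "green_L S f =
     {(x, y). x \<in> S \<and> y \<in> S \<and> principal_left_ideal S f x = principal_left_ideal S f y}"

definition green_R :: "'a set \<Rightarrow> ('a \<Rightarrow> 'a \<Rightarrow> 'a) \<Rightarrow> 'a rel" where
  "green_R S f =
     {(x, y). x \<in> S \<and> y \<in> S \<and> principal_right_ideal S f x = principal_right_ideal S f y}"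

definition green_D :: "'a set \<Rightarrow> ('a \<Rightarrow> 'a \<Rightarrow> 'a) \<Rightarrow> 'a rel" where
  "green_D S f = green_L S f O green_R S f"

definition D_class :: "'a set \<Rightarrow> ('a \<Rightarrow> 'a \<Rightarrow> 'a) \<Rightarrow> 'a \<Rightarrow> 'a set" where
  "D_class S f x = green_D S f `` {x}"

text \<open>Classes are compared through representatives; the choice of representatives is
  immaterial by \<open>D_class_le_iff\<close> below.\<close>

definition class_le :: "'a set \<Rightarrow> ('a \<Rightarrow> 'a \<Rightarrow> 'a) \<Rightarrow> 'a set \<Rightarrow> 'a set \<Rightarrow> bool" where
  "class_le S f A B \<longleftrightarrow> (\<exists>x\<in>A. \<exists>y\<in>B. x \<in> principal_ideal S f y)"

definition class_less :: "'a set \<Rightarrow> ('a \<Rightarrow> 'a \<Rightarrow> 'a) \<Rightarrow> 'a set \<Rightarrow> 'a set \<Rightarrow> bool" where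
  "class_less S f A B \<longleftrightarrow> class_le S f A B \<and> A \<noteq> B"

definition regular_elements :: "'a set \<Rightarrow> ('a \<Rightarrow> 'a \<Rightarrow> 'a) \<Rightarrow> 'a set" where
  "regular_elements S f = {x \<in> S. \<exists>y\<in>S. x = f (f x y) x}"

definition regular_D_classes :: "'a set \<Rightarrow> ('a \<Rightarrow> 'a \<Rightarrow> 'a) \<Rightarrow> 'a set set" where
  "regular_D_classes S f = {A \<in> S // green_D S f. A \<subseteq> regular_elements S f}"

lemma principal_ideal_trans:
  assumes closed: "\<And>x y. x \<in> S \<Longrightarrow> y \<in> S \<Longrightarrow> f x y \<in> S"
    and assoc: "\<And>x y z. x \<in> S \<Longrightarrow> y \<in> S \<Longrightarrow> z \<in> S \<Longrightarrow> f (f x y) z = f x (f y z)"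
    and z: "z \<in> S" and xy: "x \<in> principal_ideal S f y" and yz: "y \<in> principal_ideal S f z"
  shows "x \<in> principal_ideal S f z"
proof -
  have I: "a \<in> principal_ideal S f b \<longleftrightarrow> a = b \<or> (\<exists>u\<in>S. a = f u b) \<or> (\<exists>v\<in>S. a = f b v)
      \<or> (\<exists>u\<in>S. \<exists>v\<in>S. a = f (f u b) v)" for a b
    unfolding principal_ideal_def by blast
  have left: "f u a \<in> principal_ideal S f z" if a: "a \<in> principal_ideal S f z" and u: "u \<in> S" for u a
  proof -
    from a consider "a = z" | w where "w \<in> S" "a = f w z" | v where "v \<in> S" "a = f z v"
      | w v where "w \<in> S" "v \<in> S" "a = f (f w z) v"
      unfolding I by blast
    then show ?thesis
    proof cases
      case 1
      then show ?thesis unfolding I using u by blast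
    next
      case (2 w)
      then have "f u a = f (f u w) z" "f u w \<in> S" using assoc closed z u by simp_all
      then show ?thesis unfolding I by blast
    next
      case (3 v)
      then have "f u a = f (f u z) v" using assoc z u by simp
      then show ?thesis unfolding I using u 3 by blast
    next
      case (4 w v)
      then have "f u a = f (f (f u w) z) v" "f u w \<in> S" using assoc closed z u by simp_all
      then show ?thesis unfolding I using 4 by blast
    qed
  qed
  have right: "f a v \<in> principal_ideal S f z" if a: "a \<in> principal_ideal S f z" and v: "v \<in> S" for v a
  proof -
    from a consider "a = z" | u where "u \<in> S" "a = f u z" | w where "w \<in> S" "a = f z w"
      | u w where "u \<in> S" "w \<in> S" "a = f (f u z) w"
      unfolding I by blast
    then show ?thesis
    proof cases
      case 1
      then show ?thesis unfolding I using v by blast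
    next
      case (2 u)
      then show ?thesis unfolding I using v by blast
    next
      case (3 w)
      then have "f a v = f z (f w v)" "f w v \<in> S" using assoc closed z v by simp_all
      then show ?thesis unfolding I by blast
    next
      case (4 u w)
      then have "f a v = f (f u z) (f w v)" "f w v \<in> S" using assoc closed z v by simp_all
      then show ?thesis unfolding I using 4 by blast
    qed
  qed
  from xy consider "x = y" | u where "u \<in> S" "x = f u y" | v where "v \<in> S" "x = f y v"
    | u v where "u \<in> S" "v \<in> S" "x = f (f u y) v"
    unfolding I by blast
  then show ?thesis
    by cases (simp_all add: yz left right)
qed

lemma green_D_principal_ideal:
  assumes closed: "\<And>x y. x \<in> S \<Longrightarrow> y \<in> S \<Longrightarrow> f x y \<in> S"
    and assoc: "\<And>x y z. x \<in> S \<Longrightarrow> y \<in> S \<Longrightarrow> z \<in> S \<Longrightarrow> f (f x y) z = f x (f y z)"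
    and "(x, y) \<in> green_D S f"
  shows "x \<in> principal_ideal S f y" "y \<in> principal_ideal S f x"
proof -
  obtain z where S: "x \<in> S" "y \<in> S" "z \<in> S"
    and L: "principal_left_ideal S f x = principal_left_ideal S f z"
    and R: "principal_right_ideal S f z = principal_right_ideal S f y"
    using assms(3) unfolding green_D_def green_L_def green_R_def by blast
  have sub: "principal_left_ideal S f a \<subseteq> principal_ideal S f a"
    "principal_right_ideal S f a \<subseteq> principal_ideal S f a" for a
    unfolding principal_left_ideal_def principal_right_ideal_def principal_ideal_def by blast+
  have self: "a \<in> principal_left_ideal S f a" "a \<in> principal_right_ideal S f a" for a
    unfolding principal_left_ideal_def principal_right_ideal_def by blast+
  have m: "x \<in> principal_ideal S f z" "z \<in> principal_ideal S f x"
    "z \<in> principal_ideal S f y" "y \<in> principal_ideal S f z"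
    using sub self L R by blast+
  show "x \<in> principal_ideal S f y"
    by (rule principal_ideal_trans[OF closed assoc \<open>y \<in> S\<close> m(1) m(3)])
  show "y \<in> principal_ideal S f x"
    by (rule principal_ideal_trans[OF closed assoc \<open>x \<in> S\<close> m(4) m(2)])
qed

lemma D_class_le_iff:
  assumes closed: "\<And>x y. x \<in> S \<Longrightarrow> y \<in> S \<Longrightarrow> f x y \<in> S"
    and assoc: "\<And>x y z. x \<in> S \<Longrightarrow> y \<in> S \<Longrightarrow> z \<in> S \<Longrightarrow> f (f x y) z = f x (f y z)"
    and S: "x \<in> S" "y \<in> S"
  shows "class_le S f (D_class S f x) (D_class S f y) \<longleftrightarrow> x \<in> principal_ideal S f y"
proof
  assume "x \<in> principal_ideal S f y"
  moreover have "a \<in> D_class S f a" if "a \<in> S" for a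
    using that unfolding D_class_def green_D_def green_L_def green_R_def by auto
  ultimately show "class_le S f (D_class S f x) (D_class S f y)"
    using S unfolding class_le_def by blast
next
  assume "class_le S f (D_class S f x) (D_class S f y)"
  then obtain x' y' where xx: "(x, x') \<in> green_D S f" and yy: "(y, y') \<in> green_D S f"
    and le: "x' \<in> principal_ideal S f y'"
    unfolding class_le_def D_class_def by blast
  have y': "y' \<in> S" using yy unfolding green_D_def green_R_def by blast
  have x': "x \<in> principal_ideal S f x'" and y'y: "y' \<in> principal_ideal S f y"
    using green_D_principal_ideal[OF closed assoc xx] green_D_principal_ideal[OF closed assoc yy]
    by simp_all
  have xy': "x \<in> principal_ideal S f y'"
    by (rule principal_ideal_trans[OF closed assoc y' x' le])
  show "x \<in> principal_ideal S f y"
    by (rule principal_ideal_trans[OF closed assoc \<open>y \<in> S\<close> xy' y'y])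
qed

definition J_mat :: "nat \<Rightarrow> nat \<Rightarrow> nat \<Rightarrow> 'a::field mat" where
  "J_mat m n r =
     four_block_mat (1\<^sub>m r) (0\<^sub>m r (m - r)) (0\<^sub>m (n - r) r) (0\<^sub>m (n - r) (m - r))"

definition sandwich :: "nat \<Rightarrow> nat \<Rightarrow> nat \<Rightarrow> 'a::field mat \<Rightarrow> 'a mat \<Rightarrow> 'a mat" where
  "sandwich m n r X Y = X * J_mat m n r * Y"

text \<open>In \<open>vec_space.rank k A\<close> the parameter \<open>k\<close> is the number of rows of \<open>A\<close>.\<close>

abbreviation mat_rank :: "'a::field mat \<Rightarrow> nat" where
  "mat_rank A \<equiv> vec_space.rank (dim_row A) A"

lemma J_mat_carrier: "r \<le> min m n \<Longrightarrow> J_mat m n r \<in> carrier_mat n m"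
  unfolding J_mat_def by (rule carrier_matI) auto

lemma sandwich_closed:
  assumes "r \<le> min m n" "X \<in> carrier_mat m n" "Y \<in> carrier_mat m n"
  shows "sandwich m n r X Y \<in> carrier_mat m n"
  using assms J_mat_carrier[OF assms(1)] unfolding sandwich_def by auto

lemma sandwich_assoc:
  fixes X :: "'a::field mat"
  assumes "r \<le> min m n" "X \<in> carrier_mat m n" "Y \<in> carrier_mat m n" "Z \<in> carrier_mat m n"
  shows "sandwich m n r (sandwich m n r X Y) Z = sandwich m n r X (sandwich m n r Y Z)"
proof -
  let ?J = "J_mat m n r :: 'a mat"
  have J: "?J \<in> carrier_mat n m" using J_mat_carrier assms(1) by blast
  have XJ: "X * ?J \<in> carrier_mat m m" and YJ: "Y * ?J \<in> carrier_mat m m"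
    using assms J by auto
  have "X * ?J * Y * ?J * Z = X * ?J * (Y * ?J) * Z"
    using assoc_mult_mat[OF XJ assms(3) J] by simp
  also have "\<dots> = X * ?J * (Y * ?J * Z)"
    using assoc_mult_mat[OF XJ YJ assms(4)] by simp
  finally show ?thesis unfolding sandwich_def .
qed

end

theory Submission
  imports Defs
begin

text \<open>Everything works for an arbitrary \<open>n \<times> m\<close> matrix \<open>J\<close>; only its rank matters.
  An element of the principal ideal of \<open>Y\<close> has the form \<open>X = A Y B\<close> with \<open>J A = A' J\<close> and
  \<open>B J = J B'\<close>, so that \<open>J X J = A' (J Y J) B'\<close>. Conversely, rank \<open>U\<close> \<open>\<le>\<close> rank \<open>V\<close> makes \<open>U\<close> a
  two-sided multiple of \<open>V\<close>; taking \<open>V = J Y J\<close> puts \<open>X\<close> into the ideal of \<open>Y\<close>. Regular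
  elements satisfy rank \<open>J X J\<close> = rank \<open>X\<close>, which gives both comparisons.
  For two regular elements \<open>X = B C\<close> and \<open>Z = E F\<close> of the same rank, in full rank
  factorizations, \<open>E C\<close> is L-related to \<open>X\<close> and R-related to \<open>Z\<close>, because regularity of
  \<open>B C\<close> amounts to \<open>C J Y J B = 1\<close> for some \<open>Y\<close>.\<close>

text \<open>The carrier premises of \<open>assoc_mult_mat\<close> involve dimensions that its
  conclusion does not mention, which hampers rewriting. Premises on \<open>dim_row\<close> and
  \<open>dim_col\<close> can be discharged by the simplifier.\<close>

lemma mult_mat_assoc_dim:
  fixes A B C :: "'a::semiring_0 mat"
  assumes "dim_col A = dim_row B" "dim_col B = dim_row C"
  shows "A * B * C = A * (B * C)"
  by (rule assoc_mult_mat[of _ "dim_row A" "dim_row B" _ "dim_row C" _ "dim_col C"])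
    (use assms in auto)

section \<open>Truncated identity matrices\<close>

definition partial_id :: "nat \<Rightarrow> nat \<Rightarrow> nat \<Rightarrow> 'a::field mat" where
  "partial_id a b s = mat a b (\<lambda>(i, j). if i = j \<and> i < s then 1 else 0)"

lemma partial_id_carrier [simp]: "partial_id a b s \<in> carrier_mat a b"
  and dim_partial_id [simp]: "dim_row (partial_id a b s) = a" "dim_col (partial_id a b s) = b"
  unfolding partial_id_def by simp_all

lemma partial_id_mult_index:
  assumes "A \<in> carrier_mat b c" "i < a" "j < c" "s \<le> b"
  shows "(partial_id a b s * A) $$ (i, j) = (if i < s then A $$ (i, j) else 0)"
proof -
  have "(partial_id a b s * A) $$ (i, j)
      = (\<Sum>k\<in>{0..<b}. (if i = k \<and> i < s then 1 else 0) * A $$ (k, j))"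
    using assms by (simp add: partial_id_def scalar_prod_def)
  also have "\<dots> = (\<Sum>k\<in>{0..<b}. if k = i then (if i < s then A $$ (i, j) else 0) else 0)"
    by (rule sum.cong) auto
  also have "\<dots> = (if i < s then A $$ (i, j) else 0)"
    using assms by simp
  finally show ?thesis .
qed

text \<open>The inner dimension \<open>b\<close> has to bound \<open>s\<close> and \<open>t\<close>,
  or ones would be cut off. For \<open>s \<le> t\<close> the product of the \<open>s\<close> by
  \<open>t\<close> and the \<open>t\<close> by \<open>s\<close> truncation is the identity of size
  \<open>s\<close>.\<close>

lemma partial_id_mult:
  assumes "s \<le> b" "t \<le> b"
  shows "partial_id a b s * partial_id b c t = (partial_id a c (min s t) :: 'a::field mat)"
proof (rule eq_matI)
  fix i j assume "i < dim_row (partial_id a c (min s t) :: 'a mat)"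
    "j < dim_col (partial_id a c (min s t) :: 'a mat)"
  then have "i < a" "j < c" by simp_all
  then have "(partial_id a b s * partial_id b c t :: 'a mat) $$ (i, j)
      = (if i < s then (partial_id b c t :: 'a mat) $$ (i, j) else 0)"
    by (intro partial_id_mult_index) (use assms in auto)
  then show "(partial_id a b s * partial_id b c t :: 'a mat) $$ (i, j)
      = partial_id a c (min s t) $$ (i, j)"
    using \<open>i < a\<close> \<open>j < c\<close> assms by (simp only:) (auto simp: partial_id_def)
qed auto

lemma partial_id_eq_one: "s \<le> t \<Longrightarrow> partial_id s s t = 1\<^sub>m s"
  by (rule eq_matI) (auto simp: partial_id_def)

lemma J_mat_eq_partial_id:
  assumes "r \<le> min m n"
  shows "J_mat m n r = partial_id n m r"
  by (rule eq_matI) (use assms in \<open>auto simp: J_mat_def partial_id_def\<close>)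

section \<open>Rank and full rank factorizations\<close>

lemma mat_rank_mult_le_left:
  fixes A B :: "'a::field mat"
  assumes "dim_col A = dim_row B"
  shows "mat_rank (A * B) \<le> mat_rank A"
proof -
  interpret vec_space "TYPE('a)" "dim_row A" .
  have A: "A \<in> carrier_mat (dim_row A) (dim_col A)"
    and AB: "A * B \<in> carrier_mat (dim_row A) (dim_col B)" by auto
  have "col_space (A * B) \<subseteq> col_space A"
  proof
    fix y assume "y \<in> col_space (A * B)"
    then obtain x where x: "x \<in> carrier_vec (dim_col B)" "y = A * B *\<^sub>v x" "y \<in> carrier_vec (dim_row A)"
      unfolding col_space_eq[OF AB] by auto
    have "y = A *\<^sub>v (B *\<^sub>v x)"
      unfolding x(2) by (rule assoc_mult_mat_vec[OF A _ x(1)]) (use assms in auto)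
    moreover have "B *\<^sub>v x \<in> carrier_vec (dim_col A)" using assms by (simp add: carrier_vecI)
    ultimately show "y \<in> col_space A"
      unfolding col_space_eq[OF A] using x by auto
  qed
  then have sub: "span (set (cols (A * B))) \<subseteq> span (set (cols A))"
    unfolding col_space_def .
  have c: "set (cols A) \<subseteq> carrier_vec (dim_row A)" "set (cols (A * B)) \<subseteq> carrier_vec (dim_row A)"
    using cols_dim[of A] cols_dim[of "A * B"] by simp_all
  have ss: "subspace class_ring (span (set (cols A))) V" "subspace class_ring (span (set (cols (A * B)))) V"
    using c by (simp_all add: span_is_subspace)
  have "rank (A * B) \<le> rank A"
    unfolding rank_def
    using vectorspace.subspace_dim[OF subspace_is_vs[OF ss(1)] nested_subspaces[OF ss sub]]
      fin_dim_span_cols[OF A] fin_dim_span_cols[OF AB] by simp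
  then show ?thesis by simp
qed

text \<open>A left inverse makes \<open>B\<close> injective on vectors, so its columns are linearly
  independent. Independence is a property of the set of columns, hence distinctness is shown
  separately, by applying injectivity to unit vectors.\<close>

lemma mat_rank_left_inverse:
  fixes B :: "'a::field mat"
  assumes B: "B \<in> carrier_mat m s" and B': "B' \<in> carrier_mat s m" and inv: "B' * B = 1\<^sub>m s"
  shows "mat_rank B = s"
proof -
  interpret vec_space "TYPE('a)" m .
  have inj: "x = y" if "x \<in> carrier_vec s" "y \<in> carrier_vec s" "B *\<^sub>v x = B *\<^sub>v y" for x y
  proof -
    have "z = B' *\<^sub>v (B *\<^sub>v z)" if "z \<in> carrier_vec s" for z
      using assoc_mult_mat_vec[OF B' B that] that by (simp add: inv)
    then show ?thesis using that by metis
  qed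
  have dist: "distinct (cols B)"
    unfolding distinct_conv_nth
  proof (intro allI impI)
    fix i j assume ij: "i < length (cols B)" "j < length (cols B)" "i \<noteq> j"
    have "B *\<^sub>v unit_vec s k = col B k" if "k < s" for k
      using B that by (intro eq_vecI) (auto)
    then have "cols B ! i = B *\<^sub>v unit_vec s i" "cols B ! j = B *\<^sub>v unit_vec s j"
      using ij B by auto
    moreover have "unit_vec s i \<noteq> (unit_vec s j :: 'a vec)" using ij B by (auto simp: unit_vec_eq)
    ultimately show "cols B ! i \<noteq> cols B ! j"
      using inj[of "unit_vec s i" "unit_vec s j"] by auto
  qed
  have "lin_indpt (set (cols B))"
  proof
    assume "lin_dep (set (cols B))"
    then obtain v where v: "v \<in> carrier_vec s" "v \<noteq> 0\<^sub>v s" "B *\<^sub>v v = 0\<^sub>v m"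
      using lin_depE[OF B _ dist] by blast
    have "B *\<^sub>v 0\<^sub>v s = 0\<^sub>v m" using B by auto
    then show False using inj[of v "0\<^sub>v s"] v by auto
  qed
  from lin_indpt_full_rank[OF B dist this] show ?thesis using B by simp
qed

text \<open>Row reduction gives \<open>G = P * X\<close> with \<open>P\<close> invertible. The
  nonzero rows of \<open>G\<close> form \<open>C\<close>, and \<open>B\<close> consists of the first
  \<open>s\<close> columns of the inverse \<open>Q\<close> of \<open>P\<close>. That
  \<open>s\<close> is the rank is proved afterwards.\<close>

lemma left_right_invertible_factorization:
  fixes X :: "'a::field mat"
  assumes X: "X \<in> carrier_mat m n"
  obtains s B B' C C' where "B \<in> carrier_mat m s" "C \<in> carrier_mat s n"
    "B' \<in> carrier_mat s m" "C' \<in> carrier_mat n s"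
    "X = B * C" "B' * B = 1\<^sub>m s" "C * C' = 1\<^sub>m s"
proof -
  define G where "G = gauss_jordan_single X"
  have G: "G \<in> carrier_mat m n" "row_echelon_form G"
    using gauss_jordan_single[OF X G_def[symmetric]] by auto
  obtain P Q where PQ: "G = P * X" "P \<in> carrier_mat m m" "Q \<in> carrier_mat m m"
    "P * Q = 1\<^sub>m m" "Q * P = 1\<^sub>m m"
    using gauss_jordan_single[OF X G_def[symmetric]] by auto
  obtain f where "pivot_fun G f n"
    using G unfolding row_echelon_form_def by auto
  note p = pivot_funD[OF carrier_matD(1)[OF G(1)] this]
  \<comment> \<open>A zero row is coded by the pivot position \<open>n\<close>, so \<open>s\<close>
    counts the nonzero rows. The alternative \<open>i = m\<close> makes the least element exist when
    no row is zero.\<close>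
  define s where "s = (LEAST i. i = m \<or> f i = n)"
  have s_le: "s \<le> m" unfolding s_def by (rule Least_le) simp
  have below: "f i < n" if "i < s" for i
    using not_less_Least[of i "\<lambda>i. i = m \<or> f i = n"] that s_le p(1)[of i]
    unfolding s_def[symmetric] by auto
  have s: "s = m \<or> f s = n"
    unfolding s_def by (rule LeastI[of "\<lambda>i. i = m \<or> f i = n" m]) simp
  \<comment> \<open>Pivot positions increase strictly until they reach \<open>n\<close> and then
    stay there, so all rows from \<open>s\<close> on vanish.\<close>
  have above: "f i = n" if "s \<le> i" "i < m" for i
    using that
  proof (induction rule: dec_induct)
    case base
    then show ?case using s by auto
  next
    case (step k)
    then show ?case using p(1)[of "Suc k"] p(3)[of k] by auto
  qed
  define C where "C = (partial_id s m s :: 'a mat) * G"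
  \<comment> \<open>Right multiplication by \<open>C'\<close> selects the pivot columns, which are
    unit vectors in reduced echelon form.\<close>
  define C' where "C' = mat n s (\<lambda>(i, j). if i = f j then 1 else 0 :: 'a)"
  have C: "C \<in> carrier_mat s n" "C' \<in> carrier_mat n s" using G unfolding C_def C'_def by auto
  have C_index: "C $$ (i, j) = G $$ (i, j)" if "i < s" "j < n" for i j
    unfolding C_def using partial_id_mult_index[OF G(1) that s_le] that by simp
  \<comment> \<open>Padding \<open>C\<close> with zero rows recovers \<open>G\<close>.\<close>
  have "partial_id m s s * C = partial_id m m s * G"
    unfolding C_def using G s_le
    by (simp add: partial_id_mult mult_mat_assoc_dim[symmetric])
  also have "\<dots> = G"
  proof (rule eq_matI)
    fix i j assume "i < dim_row G" "j < dim_col G"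
    then have ij: "i < m" "j < n" using G by auto
    show "(partial_id m m s * G) $$ (i, j) = G $$ (i, j)"
      using partial_id_mult_index[OF G(1) ij s_le] above[of i] p(2)[of i j] ij by auto
  qed (use G in auto)
  finally have EC: "partial_id m s s * C = G" .
  have "Q * partial_id m s s * C = Q * (partial_id m s s * C)"
    by (rule mult_mat_assoc_dim) (use PQ(3) C in simp_all)
  also have "\<dots> = (Q * P) * X"
    unfolding EC PQ(1) by (rule mult_mat_assoc_dim[symmetric]) (use PQ(2,3) X in simp_all)
  finally have "X = Q * partial_id m s s * C"
    using X by (simp add: PQ(5))
  moreover have "partial_id s m s * P * (Q * partial_id m s s) = 1\<^sub>m s"
  proof -
    have "partial_id s m s * P * (Q * partial_id m s s) = partial_id s m s * ((P * Q) * partial_id m s s)"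
      using PQ(2,3) by (simp add: mult_mat_assoc_dim)
    also have "\<dots> = partial_id s m s * partial_id m s s"
      unfolding PQ(4) by simp
    also have "\<dots> = 1\<^sub>m s"
      using s_le by (simp add: partial_id_mult partial_id_eq_one)
    finally show ?thesis .
  qed
  moreover have "C * C' = 1\<^sub>m s"
  proof (rule eq_matI)
    fix i j assume "i < dim_row (1\<^sub>m s :: 'a mat)" "j < dim_col (1\<^sub>m s :: 'a mat)"
    then have ij: "i < s" "j < s" by auto
    then have "(C * C') $$ (i, j) = (\<Sum>k\<in>{0..<n}. C $$ (i, k) * (if k = f j then 1 else 0))"
      using C unfolding C'_def by (auto simp: scalar_prod_def)
    also have "\<dots> = (\<Sum>k\<in>{0..<n}. if k = f j then C $$ (i, k) else 0)"
      by (rule sum.cong) auto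
    also have "\<dots> = G $$ (i, f j)"
      using below[OF ij(2)] C_index ij by simp
    also have "\<dots> = 1\<^sub>m s $$ (i, j)"
      using p(4,5) ij s_le below[OF ij(2)] by auto
    finally show "(C * C') $$ (i, j) = 1\<^sub>m s $$ (i, j)" .
  qed (use C in auto)
  moreover have "Q * partial_id m s s \<in> carrier_mat m s" "partial_id s m s * P \<in> carrier_mat s m"
    using PQ(2,3) by (blast intro: mult_carrier_mat partial_id_carrier)+
  ultimately show thesis
    using C by (intro that)
qed

text \<open>Both bounds compare with \<open>B\<close>, which has rank \<open>s\<close>: passing to
  \<open>B * C\<close> cannot raise the rank, and \<open>B = (B * C) * C'\<close> shows that it does
  not lower it.\<close>

lemma mat_rank_factorization:
  fixes B :: "'a::field mat"
  assumes B: "B \<in> carrier_mat m s" "B' \<in> carrier_mat s m" "B' * B = 1\<^sub>m s"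
    and C: "C \<in> carrier_mat s n" "C' \<in> carrier_mat n s" "C * C' = 1\<^sub>m s"
  shows "mat_rank (B * C) = s"
proof (rule antisym)
  have s: "mat_rank B = s" by (rule mat_rank_left_inverse[OF B])
  then show "mat_rank (B * C) \<le> s"
    using mat_rank_mult_le_left[of B C] B C by simp
  have "B * C * C' = B"
    using B C by (simp add: mult_mat_assoc_dim right_mult_one_mat[OF B(1)])
  then show "s \<le> mat_rank (B * C)"
    using mat_rank_mult_le_left[of "B * C" C'] B C s by simp
qed

lemma full_rank_factorization:
  fixes X :: "'a::field mat"
  assumes X: "X \<in> carrier_mat m n" and s: "mat_rank X = s"
  obtains B B' C C' where "B \<in> carrier_mat m s" "C \<in> carrier_mat s n"
    "B' \<in> carrier_mat s m" "C' \<in> carrier_mat n s"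
    "X = B * C" "B' * B = 1\<^sub>m s" "C * C' = 1\<^sub>m s"
proof -
  obtain t B B' C C' where *: "B \<in> carrier_mat m t" "C \<in> carrier_mat t n"
    "B' \<in> carrier_mat t m" "C' \<in> carrier_mat n t"
    "X = B * C" "B' * B = 1\<^sub>m t" "C * C' = 1\<^sub>m t"
    using left_right_invertible_factorization[OF X] by metis
  have "t = s" using mat_rank_factorization[OF *(1,3,6,2,4,7)] * s by simp
  with * that show thesis by blast
qed

text \<open>Row spaces are avoided: with \<open>B = E * F\<close> the product factors as
  \<open>(A * E) * F\<close>, and \<open>A * E\<close> has only \<open>mat_rank B\<close>
  columns.\<close>

lemma mat_rank_mult_le_right:
  fixes A B :: "'a::field mat"
  assumes AB: "dim_col A = dim_row B"
  shows "mat_rank (A * B) \<le> mat_rank B"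
proof -
  define s where "s = mat_rank B"
  have "B \<in> carrier_mat (dim_row B) (dim_col B)" by simp
  then obtain E E' F F' where E: "E \<in> carrier_mat (dim_row B) s"
    and F: "F \<in> carrier_mat s (dim_col B)" and B: "B = E * F"
    by (rule full_rank_factorization[OF _ s_def[symmetric]])
  have "A * B = A * E * F"
    unfolding B by (rule mult_mat_assoc_dim[symmetric]) (use AB E F in simp_all)
  then have "mat_rank (A * B) \<le> mat_rank (A * E)"
    using mat_rank_mult_le_left[of "A * E" F] E F by simp
  moreover have "A * E \<in> carrier_mat (dim_row A) s"
    using E by (intro carrier_matI) simp_all
  then have "mat_rank (A * E) \<le> s"
    using vec_space.rank_le_nc[of "A * E" "dim_row A" s] by simp
  ultimately show ?thesis unfolding s_def by linarith
qed

lemma mat_rank_mult3_le: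
  fixes A B C :: "'a::field mat"
  assumes "dim_col A = dim_row B" "dim_col B = dim_row C"
  shows "mat_rank (A * B * C) \<le> mat_rank B"
proof -
  have "mat_rank (A * B * C) \<le> mat_rank (A * B)"
    using mat_rank_mult_le_left[of "A * B" C] assms by simp
  also have "\<dots> \<le> mat_rank B"
    using mat_rank_mult_le_right[of A B] assms by simp
  finally show ?thesis .
qed

text \<open>The one-sided inverses \<open>E'\<close> and \<open>F'\<close> reduce \<open>V\<close>
  to the identity of size \<open>t\<close>. Truncating this to size \<open>s \<le> t\<close> leaves
  the middle of the factorization of \<open>U\<close>.\<close>

lemma mat_rank_le_imp_factor:
  fixes U V :: "'a::field mat"
  assumes U: "U \<in> carrier_mat k l" and V: "V \<in> carrier_mat p q" and le: "mat_rank U \<le> mat_rank V"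
  obtains A B where "A \<in> carrier_mat k p" "B \<in> carrier_mat q l" "U = A * V * B"
proof -
  define s t where "s = mat_rank U" and "t = mat_rank V"
  obtain B B' C C' where BC: "B \<in> carrier_mat k s" "C \<in> carrier_mat s l"
    "B' \<in> carrier_mat s k" "C' \<in> carrier_mat l s" "U = B * C" "B' * B = 1\<^sub>m s" "C * C' = 1\<^sub>m s"
    by (rule full_rank_factorization[OF U s_def[symmetric]])
  obtain E E' F F' where EF: "E \<in> carrier_mat p t" "F \<in> carrier_mat t q"
    "E' \<in> carrier_mat t p" "F' \<in> carrier_mat q t" "V = E * F" "E' * E = 1\<^sub>m t" "F * F' = 1\<^sub>m t"
    by (rule full_rank_factorization[OF V t_def[symmetric]])
  let ?K = "partial_id s t s :: 'a mat" and ?L = "partial_id t s s :: 'a mat"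
  have st: "s \<le> t" using le s_def t_def by simp
  have "E' * V * F' = (E' * E) * (F * F')"
    unfolding EF(5) using EF(1-4) by (simp add: mult_mat_assoc_dim)
  then have V1: "E' * V * F' = 1\<^sub>m t" using EF by simp
  have "(B * ?K * E') * V * (F' * ?L * C) = B * ?K * (E' * V * F') * ?L * C"
    using BC(1-4) EF(1-4) V by (simp add: mult_mat_assoc_dim)
  also have "\<dots> = B * (?K * ?L) * C"
    unfolding V1 using BC(1-4) by (simp add: mult_mat_assoc_dim left_mult_one_mat[of _ t s])
  also have "\<dots> = U"
    using BC st by (simp add: partial_id_mult partial_id_eq_one)
  finally have "U = (B * ?K * E') * V * (F' * ?L * C)" by simp
  then show thesis
    by (rule that[rotated 2]) (use BC(1-4) EF(1-4) in \<open>blast intro: mult_carrier_mat partial_id_carrier\<close>)+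
qed

section \<open>Green's relations in an abstract semigroup\<close>

lemma green_LI:
  assumes closed: "\<And>x y. x \<in> S \<Longrightarrow> y \<in> S \<Longrightarrow> f x y \<in> S"
    and assoc: "\<And>x y z. x \<in> S \<Longrightarrow> y \<in> S \<Longrightarrow> z \<in> S \<Longrightarrow> f (f x y) z = f x (f y z)"
    and S: "x \<in> S" "y \<in> S" "a \<in> S" "b \<in> S" and xy: "x = f a y" and yx: "y = f b x"
  shows "(x, y) \<in> green_L S f"
proof -
  have sub: "principal_left_ideal S f u \<subseteq> principal_left_ideal S f v"
    if vc: "v \<in> S" "c \<in> S" and u: "u = f c v" for u v c
  proof
    fix w assume "w \<in> principal_left_ideal S f u"
    then consider "w = f c v" | d where "d \<in> S" "w = f d (f c v)"
      unfolding principal_left_ideal_def u by auto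
    then have "\<exists>e\<in>S. w = f e v"
      by cases (use assoc closed vc in metis)+
    then show "w \<in> principal_left_ideal S f v"
      unfolding principal_left_ideal_def by blast
  qed
  show ?thesis
    unfolding green_L_def using sub[OF S(2,3) xy] sub[OF S(1,4) yx] S by blast
qed

lemma green_RI:
  assumes closed: "\<And>x y. x \<in> S \<Longrightarrow> y \<in> S \<Longrightarrow> f x y \<in> S"
    and assoc: "\<And>x y z. x \<in> S \<Longrightarrow> y \<in> S \<Longrightarrow> z \<in> S \<Longrightarrow> f (f x y) z = f x (f y z)"
    and S: "x \<in> S" "y \<in> S" "a \<in> S" "b \<in> S" and xy: "x = f y a" and yx: "y = f x b"
  shows "(x, y) \<in> green_R S f"
proof -
  have sub: "principal_right_ideal S f u \<subseteq> principal_right_ideal S f v"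
    if vc: "v \<in> S" "c \<in> S" and u: "u = f v c" for u v c
  proof
    fix w assume "w \<in> principal_right_ideal S f u"
    then consider "w = f v c" | d where "d \<in> S" "w = f (f v c) d"
      unfolding principal_right_ideal_def u by auto
    then have "\<exists>e\<in>S. w = f v e"
      by cases (use assoc closed vc in metis)+
    then show "w \<in> principal_right_ideal S f v"
      unfolding principal_right_ideal_def by blast
  qed
  show ?thesis
    unfolding green_R_def using sub[OF S(2,3) xy] sub[OF S(1,4) yx] S by blast
qed

text \<open>Regularity is carried along L and then along R. If \<open>x = x w x\<close>,
  \<open>x = a z\<close> and \<open>z = b x\<close>, then
  \<open>z = b x w x = z w x = z (w a) z\<close>; the second half is dual.\<close>

lemma green_D_regular:
  assumes closed: "\<And>x y. x \<in> S \<Longrightarrow> y \<in> S \<Longrightarrow> f x y \<in> S"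
    and assoc: "\<And>x y z. x \<in> S \<Longrightarrow> y \<in> S \<Longrightarrow> z \<in> S \<Longrightarrow> f (f x y) z = f x (f y z)"
    and D: "(x, y) \<in> green_D S f" and x: "x \<in> regular_elements S f"
  shows "y \<in> regular_elements S f"
proof -
  obtain z where L: "(x, z) \<in> green_L S f" and R: "(z, y) \<in> green_R S f"
    using D unfolding green_D_def by blast
  have "z \<in> regular_elements S f"
  \<comment> \<open>Equal ideals yield multipliers in \<open>S\<close> only for distinct elements,
    since for equal ones the adjoined identity may be the sole witness.\<close>
  proof (cases "x = z")
    case False
    obtain w where w: "w \<in> S" "x = f (f x w) x"
      using x unfolding regular_elements_def by blast
    have S: "x \<in> S" "z \<in> S"
      and eq: "principal_left_ideal S f x = principal_left_ideal S f z"
      using L unfolding green_L_def by auto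
    have "x \<in> principal_left_ideal S f z" "z \<in> principal_left_ideal S f x"
      using eq unfolding principal_left_ideal_def by auto
    then obtain a b where ab: "a \<in> S" "x = f a z" "b \<in> S" "z = f b x"
      using False unfolding principal_left_ideal_def by auto
    have "z = f b (f (f x w) x)"
      using ab(4) w(2) by metis
    also have "\<dots> = f (f z w) x"
      using assoc closed S w(1) ab by metis
    also have "\<dots> = f (f z (f w a)) z"
      using assoc closed S w(1) ab(1,2) by metis
    finally show ?thesis
      using S closed w(1) ab(1) unfolding regular_elements_def by blast
  qed (use x in simp)
  then obtain w where w: "w \<in> S" "z = f (f z w) z"
    unfolding regular_elements_def by blast
  show ?thesis
  proof (cases "z = y")
    case True
    then show ?thesis using \<open>z \<in> regular_elements S f\<close> by simp
  next
    case False
    have S: "z \<in> S" "y \<in> S"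
      and eq: "principal_right_ideal S f z = principal_right_ideal S f y"
      using R unfolding green_R_def by auto
    have "z \<in> principal_right_ideal S f y" "y \<in> principal_right_ideal S f z"
      using eq unfolding principal_right_ideal_def by auto
    then obtain a b where ab: "a \<in> S" "z = f y a" "b \<in> S" "y = f z b"
      using False unfolding principal_right_ideal_def by auto
    have "y = f (f (f z w) z) b"
      using ab(4) w(2) by metis
    also have "\<dots> = f (f z w) y"
      using assoc closed S w(1) ab by metis
    also have "\<dots> = f (f y (f a w)) y"
      using assoc closed S w(1) ab(1,2) by metis
    finally show ?thesis
      using S closed w(1) ab(1) unfolding regular_elements_def by blast
  qed
qed

section \<open>The sandwich semigroup of an arbitrary matrix \<open>J\<close>\<close>

locale matrix_sandwich =
  fixes m n :: nat and J :: "'a::field mat"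
  assumes J: "J \<in> carrier_mat n m"
begin

abbreviation M :: "'a mat set" where
  "M \<equiv> carrier_mat m n"

definition star :: "'a mat \<Rightarrow> 'a mat \<Rightarrow> 'a mat" where
  "star X Y = X * J * Y"

abbreviation P :: "'a mat set" where
  "P \<equiv> regular_elements M star"

lemma star_closed: "X \<in> M \<Longrightarrow> Y \<in> M \<Longrightarrow> star X Y \<in> M"
  unfolding star_def using J by (intro carrier_matI) simp_all

lemma star_assoc:
  "X \<in> M \<Longrightarrow> Y \<in> M \<Longrightarrow> Z \<in> M \<Longrightarrow> star (star X Y) Z = star X (star Y Z)"
  unfolding star_def using J by (simp add: mult_mat_assoc_dim)

text \<open>Each multiplier is an identity matrix or has the form \<open>U * J\<close> on the left,
  \<open>J * V\<close> on the right. Since \<open>J (U J) = (J U) J\<close>, each has a partner on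
  the other side of \<open>J\<close>, and the four kinds of ideal elements are treated
  uniformly.\<close>

lemma principal_ideal_factor:
  assumes Y: "Y \<in> M" and X: "X \<in> principal_ideal M star Y"
  obtains A B A' B' where "A \<in> carrier_mat m m" "B \<in> carrier_mat n n"
    "A' \<in> carrier_mat n n" "B' \<in> carrier_mat m m"
    "X = A * Y * B" "J * A = A' * J" "B * J = J * B'"
proof -
  define left where "left A A' \<longleftrightarrow> A \<in> carrier_mat m m \<and> A' \<in> carrier_mat n n \<and> J * A = A' * J"
    for A A' :: "'a mat"
  define right where "right B B' \<longleftrightarrow> B \<in> carrier_mat n n \<and> B' \<in> carrier_mat m m \<and> B * J = J * B'"
    for B B' :: "'a mat"
  have one: "left (1\<^sub>m m) (1\<^sub>m n)" "right (1\<^sub>m n) (1\<^sub>m m)"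
    using J unfolding left_def right_def by simp_all
  have UJ: "left (U * J) (J * U)" and JU: "right (J * U) (U * J)" if "U \<in> M" for U
    using J that unfolding left_def right_def
    by (auto simp: mult_mat_assoc_dim intro!: carrier_matI)
  consider "X = Y" | U where "U \<in> M" "X = U * J * Y" | V where "V \<in> M" "X = Y * J * V"
    | U V where "U \<in> M" "V \<in> M" "X = U * J * Y * J * V"
    using X unfolding principal_ideal_def star_def by blast
  then have "\<exists>A A' B B'. left A A' \<and> right B B' \<and> X = A * Y * B"
  proof cases
    case 1
    then have "X = 1\<^sub>m m * Y * 1\<^sub>m n" using Y by simp
    with one show ?thesis by blast
  next
    case (2 U)
    then have "X = U * J * Y * 1\<^sub>m n" using Y J by simp
    with one UJ 2 show ?thesis by blast
  next
    case (3 V)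
    then have "X = 1\<^sub>m m * Y * (J * V)" using Y J by (simp add: mult_mat_assoc_dim)
    with one JU 3 show ?thesis by blast
  next
    case (4 U V)
    then have "X = U * J * Y * (J * V)" using Y J by (simp add: mult_mat_assoc_dim)
    with UJ JU 4 show ?thesis by blast
  qed
  then show thesis using that unfolding left_def right_def by blast
qed

lemma principal_ideal_rank_le:
  assumes Y: "Y \<in> M" and X: "X \<in> principal_ideal M star Y"
  shows "mat_rank X \<le> mat_rank Y" and "mat_rank (J * X * J) \<le> mat_rank (J * Y * J)"
proof -
  obtain A B A' B' where c: "A \<in> carrier_mat m m" "B \<in> carrier_mat n n"
    "A' \<in> carrier_mat n n" "B' \<in> carrier_mat m m"
    and eq: "X = A * Y * B" "J * A = A' * J" "B * J = J * B'"
    by (rule principal_ideal_factor[OF Y X])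
  show "mat_rank X \<le> mat_rank Y"
    unfolding eq(1) by (rule mat_rank_mult3_le) (use c Y in simp_all)
  have "J * X * J = (J * A) * Y * (B * J)"
    unfolding eq(1) using c(1,2) Y J by (simp add: mult_mat_assoc_dim)
  also have "\<dots> = A' * (J * Y * J) * B'"
    unfolding eq(2,3) using c(3,4) Y J by (simp add: mult_mat_assoc_dim)
  finally show "mat_rank (J * X * J) \<le> mat_rank (J * Y * J)"
    using mat_rank_mult3_le[of A' "J * Y * J" B'] c(3,4) Y J by simp
qed

text \<open>As \<open>J * Y * J\<close> is \<open>n\<close> by \<open>m\<close>, the outer factors
  of \<open>X = A (J Y J) B\<close> are themselves \<open>m\<close> by \<open>n\<close>, so this
  product is the sandwich product of \<open>A\<close>, \<open>Y\<close> and
  \<open>B\<close>.\<close>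

lemma mat_rank_le_imp_principal_ideal:
  assumes X: "X \<in> M" and Y: "Y \<in> M" and le: "mat_rank X \<le> mat_rank (J * Y * J)"
  shows "X \<in> principal_ideal M star Y"
proof -
  have "J * Y * J \<in> carrier_mat n m" using J Y by (intro carrier_matI) simp_all
  then obtain A B where AB: "A \<in> M" "B \<in> M" "X = A * (J * Y * J) * B"
    using mat_rank_le_imp_factor[OF X _ le] by blast
  then have "X = star (star A Y) B"
    using Y J unfolding star_def by (simp add: mult_mat_assoc_dim)
  then show ?thesis using AB unfolding principal_ideal_def by blast
qed

text \<open>The equation is nested to the right because this is the normal form under
  \<open>mult_mat_assoc_dim\<close>.\<close>

lemma regularE:
  assumes "X \<in> P"
  obtains Y where "X \<in> M" "Y \<in> M" "X = X * (J * (Y * (J * X)))"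
proof -
  obtain Y where "X \<in> M" "Y \<in> M" "X = star (star X Y) X"
    using assms unfolding regular_elements_def by blast
  moreover from this have "star (star X Y) X = X * (J * (Y * (J * X)))"
    unfolding star_def using J by (simp add: mult_mat_assoc_dim)
  ultimately show thesis using that by simp
qed

lemma regularI:
  assumes "X \<in> M" "Y \<in> M" "X * (J * (Y * (J * X))) = X"
  shows "X \<in> P"
proof -
  have "star (star X Y) X = X * (J * (Y * (J * X)))"
    unfolding star_def using assms(1,2) J by (simp add: mult_mat_assoc_dim)
  then have "X = star (star X Y) X" using assms(3) by simp
  then show ?thesis using assms(1,2) unfolding regular_elements_def by blast
qed

lemma mat_rank_sandwiched_le:
  assumes "X \<in> M"
  shows "mat_rank (J * X * J) \<le> mat_rank X"
  by (rule mat_rank_mult3_le) (use assms J in simp_all)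

lemma regular_mat_rank_sandwiched:
  assumes "X \<in> P"
  shows "mat_rank (J * X * J) = mat_rank X"
proof (rule antisym)
  obtain Y where XY: "X \<in> M" "Y \<in> M" and eq: "X = X * (J * (Y * (J * X)))"
    by (rule regularE[OF assms])
  show "mat_rank (J * X * J) \<le> mat_rank X"
    by (rule mat_rank_sandwiched_le[OF XY(1)])
  \<comment> \<open>Substituting the regularity equation for its last \<open>X\<close> makes
    \<open>J * X * J\<close> appear as a factor of \<open>X\<close>.\<close>
  have "X * (J * (Y * (J * X))) = X * (J * (Y * (J * (X * (J * (Y * (J * X)))))))"
    using eq by metis
  with eq have "X = X * (J * (Y * (J * (X * (J * (Y * (J * X)))))))" by metis
  also have "\<dots> = (X * J * Y) * (J * X * J) * (Y * J * X)"
    using XY J by (simp add: mult_mat_assoc_dim)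
  finally have "mat_rank X = mat_rank ((X * J * Y) * (J * X * J) * (Y * J * X))" by metis
  also have "\<dots> \<le> mat_rank (J * X * J)"
    by (rule mat_rank_mult3_le) (use XY J in simp_all)
  finally show "mat_rank X \<le> mat_rank (J * X * J)" .
qed

section \<open>The order on D-classes\<close>

lemma class_le_iff_principal_ideal:
  assumes "X \<in> M" "Y \<in> M"
  shows "class_le M star (D_class M star X) (D_class M star Y) \<longleftrightarrow> X \<in> principal_ideal M star Y"
  by (rule D_class_le_iff[OF star_closed star_assoc assms])

text \<open>Regularity of \<open>X\<close> serves the forward direction: rank \<open>X\<close> =
  rank \<open>J X J\<close> \<le> rank \<open>J Y J\<close>, the inequality being monotonicity along
  ideals.\<close>

lemma class_le_iff_rank_le_sandwiched:
  assumes X: "X \<in> P" and Y: "Y \<in> M"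
  shows "class_le M star (D_class M star X) (D_class M star Y) \<longleftrightarrow> mat_rank X \<le> mat_rank (J * Y * J)"
proof -
  have XM: "X \<in> M" using X unfolding regular_elements_def by blast
  show ?thesis
    unfolding class_le_iff_principal_ideal[OF XM Y]
    using principal_ideal_rank_le(2)[OF Y, of X] regular_mat_rank_sandwiched[OF X]
      mat_rank_le_imp_principal_ideal[OF XM Y] by auto
qed

text \<open>Here regularity of \<open>Y\<close> serves the backward direction, by turning rank
  \<open>Y\<close> into rank \<open>J Y J\<close>.\<close>

lemma class_le_iff_rank_le:
  assumes X: "X \<in> M" and Y: "Y \<in> P"
  shows "class_le M star (D_class M star X) (D_class M star Y) \<longleftrightarrow> mat_rank X \<le> mat_rank Y"
proof -
  have YM: "Y \<in> M" using Y unfolding regular_elements_def by blast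
  show ?thesis
    unfolding class_le_iff_principal_ideal[OF X YM]
    using principal_ideal_rank_le(1)[OF YM, of X] regular_mat_rank_sandwiched[OF Y]
      mat_rank_le_imp_principal_ideal[OF X YM] by auto
qed

section \<open>The regular D-classes\<close>

lemma regular_factorization:
  assumes X: "X \<in> P" and s: "mat_rank X = s"
  obtains B C Y where "B \<in> carrier_mat m s" "C \<in> carrier_mat s n" "Y \<in> M"
    "X = B * C" "C * J * Y * J * B = 1\<^sub>m s"
proof -
  obtain Y where XY: "X \<in> M" "Y \<in> M" and eq: "X = X * (J * (Y * (J * X)))"
    by (rule regularE[OF X])
  obtain B B' C C' where BC: "B \<in> carrier_mat m s" "C \<in> carrier_mat s n"
    "B' \<in> carrier_mat s m" "C' \<in> carrier_mat n s" and XBC: "X = B * C"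
    and inv: "B' * B = 1\<^sub>m s" "C * C' = 1\<^sub>m s"
    by (rule full_rank_factorization[OF XY(1) s])
  have K: "C * J * Y * J * B \<in> carrier_mat s s"
    using BC J XY(2) by (intro carrier_matI) simp_all
  \<comment> \<open>Framing the matrix by \<open>B'\<close> and \<open>B\<close> on the left and by
    \<open>C\<close> and \<open>C'\<close> on the right produces \<open>X J Y J X\<close>, which
    regularity collapses to \<open>X\<close>.\<close>
  have "C * J * Y * J * B = (B' * B) * (C * J * Y * J * B) * (C * C')"
    unfolding inv left_mult_one_mat[OF K] right_mult_one_mat[OF K] ..
  also have "\<dots> = B' * (X * (J * (Y * (J * X)))) * C'"
    unfolding XBC using BC J XY(2) by (simp add: mult_mat_assoc_dim)
  also have "\<dots> = B' * X * C'" using eq by metis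
  also have "\<dots> = (B' * B) * (C * C')"
    unfolding XBC using BC by (simp add: mult_mat_assoc_dim)
  also have "\<dots> = 1\<^sub>m s" unfolding inv by simp
  finally show thesis using that BC XBC XY(2) by blast
qed

lemma regular_same_rank_green_D:
  assumes X: "X \<in> P" and Z: "Z \<in> P" and rank: "mat_rank Z = mat_rank X"
  shows "(X, Z) \<in> green_D M star"
proof -
  define s where "s = mat_rank X"
  obtain B C Y where c: "B \<in> carrier_mat m s" "C \<in> carrier_mat s n" "Y \<in> M"
    and X_eq: "X = B * C" and one: "C * J * Y * J * B = 1\<^sub>m s"
    by (rule regular_factorization[OF X s_def[symmetric]])
  obtain E F U where d: "E \<in> carrier_mat m s" "F \<in> carrier_mat s n" "U \<in> M"
    and Z_eq: "Z = E * F" and one': "F * J * U * J * E = 1\<^sub>m s"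
    by (rule regular_factorization[OF Z rank[folded s_def]])
  \<comment> \<open>\<open>W\<close> shares the right factor \<open>C\<close> with \<open>X\<close>
    and the left factor \<open>E\<close> with \<open>Z\<close>. The multipliers below exchange the
    other factor: \<open>B F J U\<close> turns \<open>E\<close> into \<open>B\<close> because
    \<open>F J U J E = 1\<close>, and likewise for the rest.\<close>
  define W where "W = E * C"
  have M: "X \<in> M" "Z \<in> M" "W \<in> M" "B * F * J * U \<in> M" "E * C * J * Y \<in> M"
    "U * J * E * C \<in> M" "Y * J * B * F \<in> M"
    unfolding X_eq Z_eq W_def using c d J by (auto intro!: carrier_matI)
  have "star (B * F * J * U) W = B * (F * J * U * J * E) * C"
    unfolding star_def W_def using c d J by (simp add: mult_mat_assoc_dim)
  then have XW: "X = star (B * F * J * U) W" unfolding one' X_eq using c by simp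
  have "star (E * C * J * Y) X = E * (C * J * Y * J * B) * C"
    unfolding star_def X_eq using c d J by (simp add: mult_mat_assoc_dim)
  then have WX: "W = star (E * C * J * Y) X" unfolding one W_def using c d by simp
  have "star Z (U * J * E * C) = E * (F * J * U * J * E) * C"
    unfolding star_def Z_eq using c d J by (simp add: mult_mat_assoc_dim)
  then have WZ: "W = star Z (U * J * E * C)" unfolding one' W_def using c d by simp
  have "star W (Y * J * B * F) = E * (C * J * Y * J * B) * F"
    unfolding star_def W_def using c d J by (simp add: mult_mat_assoc_dim)
  then have ZW: "Z = star W (Y * J * B * F)" unfolding one Z_eq using c d by simp
  have "(X, W) \<in> green_L M star"
    by (rule green_LI[of M star, OF star_closed star_assoc M(1,3,4,5) XW WX])
  moreover have "(W, Z) \<in> green_R M star"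
    by (rule green_RI[of M star, OF star_closed star_assoc M(3,2,6,7) WZ ZW])
  ultimately show ?thesis unfolding green_D_def by blast
qed

text \<open>D-related elements lie in each other's principal ideals, so their ranks agree, and they
  inherit regularity. The converse inclusion is the construction through \<open>W\<close>.\<close>

lemma D_class_regular:
  assumes X: "X \<in> P"
  shows "D_class M star X = {Z \<in> P. mat_rank Z = mat_rank X}"
proof (intro Set.set_eqI iffI)
  fix Z assume "Z \<in> D_class M star X"
  then have D: "(X, Z) \<in> green_D M star" unfolding D_class_def by blast
  then have M: "X \<in> M" "Z \<in> M"
    unfolding green_D_def green_L_def green_R_def by auto
  have XZ: "X \<in> principal_ideal M star Z"
    by (rule green_D_principal_ideal(1)[OF star_closed star_assoc D])
  have ZX: "Z \<in> principal_ideal M star X"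
    by (rule green_D_principal_ideal(2)[OF star_closed star_assoc D])
  have "Z \<in> P" by (rule green_D_regular[of M star, OF star_closed star_assoc D X])
  moreover have "mat_rank Z = mat_rank X"
    by (rule antisym[OF principal_ideal_rank_le(1)[OF M(1) ZX] principal_ideal_rank_le(1)[OF M(2) XZ]])
  ultimately show "Z \<in> {Z \<in> P. mat_rank Z = mat_rank X}" by blast
next
  fix Z assume "Z \<in> {Z \<in> P. mat_rank Z = mat_rank X}"
  then show "Z \<in> D_class M star X"
    using regular_same_rank_green_D[OF X] unfolding D_class_def by blast
qed

lemma regular_mat_rank_le:
  assumes "X \<in> P"
  shows "mat_rank X \<le> mat_rank J"
proof -
  have X: "X \<in> M" using assms unfolding regular_elements_def by blast
  have "mat_rank X = mat_rank (J * (X * J))"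
    using regular_mat_rank_sandwiched[OF assms] X J by (simp add: mult_mat_assoc_dim)
  also have "\<dots> \<le> mat_rank J"
    by (rule mat_rank_mult_le_left) (use X J in simp)
  finally show ?thesis .
qed

lemma regular_of_rank_exists:
  assumes s: "s \<le> mat_rank J"
  obtains X where "X \<in> P" "mat_rank X = s"
proof -
  define t where "t = mat_rank J"
  obtain L L' R R' where c: "L \<in> carrier_mat n t" "R \<in> carrier_mat t m"
    "L' \<in> carrier_mat t n" "R' \<in> carrier_mat m t"
    and J_eq: "J = L * R" and inv: "L' * L = 1\<^sub>m t" "R * R' = 1\<^sub>m t"
    by (rule full_rank_factorization[OF J t_def[symmetric]])
  let ?K = "partial_id t s s :: 'a mat" and ?K' = "partial_id s t s :: 'a mat"
  have KK: "?K' * ?K = 1\<^sub>m s"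
    using s t_def by (simp add: partial_id_mult partial_id_eq_one)
  \<comment> \<open>With \<open>J = L * R\<close> these choices give
    \<open>C J B = K' (L' L) (R R') K = K' K = 1\<close>, where \<open>K\<close> and
    \<open>K'\<close> are the truncations. Hence \<open>B * C\<close> is idempotent under
    \<open>star\<close>, and its regularity is witnessed by itself.\<close>
  define B C where "B = R' * ?K" and "C = ?K' * L'"
  have BC: "B \<in> carrier_mat m s" "C \<in> carrier_mat s n" "B * C \<in> M"
    "?K' * R \<in> carrier_mat s m" "L * ?K \<in> carrier_mat n s"
    unfolding B_def C_def using c by (auto intro!: carrier_matI)
  have "(?K' * R) * B = ?K' * (R * R') * ?K"
    unfolding B_def using c by (simp add: mult_mat_assoc_dim)
  also have "\<dots> = ?K' * ?K"
    unfolding inv using right_mult_one_mat[of ?K' s t] by simp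
  finally have B_inv: "(?K' * R) * B = 1\<^sub>m s" using KK by simp
  have "C * (L * ?K) = ?K' * (L' * L) * ?K"
    unfolding C_def using c by (simp add: mult_mat_assoc_dim)
  also have "\<dots> = ?K' * ?K"
    unfolding inv using right_mult_one_mat[of ?K' s t] by simp
  finally have C_inv: "C * (L * ?K) = 1\<^sub>m s" using KK by simp
  have rank: "mat_rank (B * C) = s"
    by (rule mat_rank_factorization[OF BC(1,4) B_inv BC(2,5) C_inv])
  have "C * J * B = ?K' * (L' * L) * (R * R') * ?K"
    unfolding B_def C_def J_eq using c by (simp add: mult_mat_assoc_dim)
  also have "\<dots> = ?K' * ?K"
    unfolding inv using right_mult_one_mat[of ?K' s t] by simp
  finally have one: "C * J * B = 1\<^sub>m s" using KK by simp
  have "B * C * (J * (B * C * (J * (B * C)))) = B * (C * J * B) * (C * J * B) * C"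
    using BC(1,2) J by (simp add: mult_mat_assoc_dim)
  also have "\<dots> = B * C" unfolding one using BC(1,2) by simp
  finally have "B * C \<in> P" by (rule regularI[OF BC(3) BC(3)])
  then show thesis using that rank by blast
qed

text \<open>The bound on ranks of regular elements limits the index range, and the existence of a
  regular element of each rank in it makes every listed set a genuine class.\<close>

lemma regular_D_classes_eq:
  "regular_D_classes M star = (\<lambda>s. {X \<in> P. mat_rank X = s}) ` {0..mat_rank J}"
proof (intro Set.set_eqI iffI)
  fix A assume "A \<in> regular_D_classes M star"
  then obtain X where X: "X \<in> M" "A = D_class M star X" "A \<subseteq> P"
    unfolding regular_D_classes_def D_class_def quotient_def by blast
  have "X \<in> A"
    using X(1) unfolding X(2) D_class_def green_D_def green_L_def green_R_def by auto
  then have "X \<in> P" using X(3) by blast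
  then show "A \<in> (\<lambda>s. {X \<in> P. mat_rank X = s}) ` {0..mat_rank J}"
    using D_class_regular regular_mat_rank_le X(2) by auto
next
  fix A assume "A \<in> (\<lambda>s. {X \<in> P. mat_rank X = s}) ` {0..mat_rank J}"
  then obtain s where s: "s \<le> mat_rank J" "A = {X \<in> P. mat_rank X = s}" by auto
  obtain X where X: "X \<in> P" "mat_rank X = s" by (rule regular_of_rank_exists[OF s(1)])
  then have "A = D_class M star X" using D_class_regular[OF X(1)] s(2) by simp
  moreover have "X \<in> M" using X(1) unfolding regular_elements_def by blast
  ultimately show "A \<in> regular_D_classes M star"
    using s(2) unfolding regular_D_classes_def D_class_def by (auto intro: quotientI)
qed

lemma class_less_iff:
  assumes s: "s \<le> mat_rank J" and t: "t \<le> mat_rank J"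
  shows "class_less M star {X \<in> P. mat_rank X = s} {X \<in> P. mat_rank X = t} \<longleftrightarrow> s < t"
proof -
  obtain X where X: "X \<in> P" "mat_rank X = s" by (rule regular_of_rank_exists[OF s])
  obtain Y where Y: "Y \<in> P" "mat_rank Y = t" by (rule regular_of_rank_exists[OF t])
  have "X \<in> M" using X(1) unfolding regular_elements_def by blast
  from class_le_iff_rank_le[OF this Y(1)]
  have "class_le M star {X \<in> P. mat_rank X = s} {X \<in> P. mat_rank X = t} \<longleftrightarrow> s \<le> t"
    unfolding D_class_regular[OF X(1)] D_class_regular[OF Y(1)] X(2) Y(2) .
  \<comment> \<open>The representative \<open>X\<close> shows that the first set is nonempty, so
    equality of the sets forces equality of the ranks.\<close>
  moreover have "{X \<in> P. mat_rank X = s} = {X \<in> P. mat_rank X = t} \<longleftrightarrow> s = t"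
    using X by blast
  ultimately show ?thesis unfolding class_less_def by auto
qed

end

section \<open>The given matrix \<open>J\<close> and the theorem\<close>

lemma mat_rank_J_mat:
  assumes "r \<le> min m n"
  shows "mat_rank (J_mat m n r :: 'a::field mat) = r"
proof -
  let ?I = "\<lambda>a b. partial_id a b r :: 'a mat"
  \<comment> \<open>\<open>J\<close> splits through dimension \<open>r\<close> into two truncated
    identities, whose one-sided inverses are again truncated identities.\<close>
  have "mat_rank (?I n r * ?I r m) = r"
    by (rule mat_rank_factorization[of "?I n r" n r "?I r n" "?I r m" m "?I m r"])
      (use assms in \<open>simp_all add: partial_id_mult partial_id_eq_one\<close>)
  then show ?thesis
    using assms by (simp add: J_mat_eq_partial_id partial_id_mult)
qed

theorem proposition4p7:
  fixes m n r :: nat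
    and M :: "'a::field mat set"
    and star :: "'a mat \<Rightarrow> 'a mat \<Rightarrow> 'a mat"
    and J :: "'a mat"
    and P :: "'a mat set"
    and D :: "nat \<Rightarrow> 'a mat set"
  assumes "m \<ge> 1" and "n \<ge> 1" and "r \<le> min m n"
  defines "M \<equiv> carrier_mat m n"
    and "star \<equiv> sandwich m n r"
    and "J \<equiv> J_mat m n r"
    and "P \<equiv> regular_elements M star"
    and "D \<equiv> \<lambda>s. {X \<in> P. mat_rank X = s}"
  shows "(\<forall>X\<in>M. \<forall>Y\<in>M.
            (X \<in> P \<longrightarrow>
               (class_le M star (D_class M star X) (D_class M star Y)
                  \<longleftrightarrow> mat_rank X \<le> mat_rank (J * Y * J)))
          \<and> (Y \<in> P \<longrightarrow>
               (class_le M star (D_class M star X) (D_class M star Y)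
                  \<longleftrightarrow> mat_rank X \<le> mat_rank Y)))
       \<and> regular_D_classes M star = D ` {0..r}
       \<and> (\<forall>s\<in>{0..r}. \<forall>t\<in>{0..r}. class_less M star (D s) (D t) \<longleftrightarrow> s < t)"
proof -
  interpret S: matrix_sandwich m n J
    unfolding J_def by unfold_locales (rule J_mat_carrier[OF assms(3)])
  have star: "star = S.star"
    unfolding star_def by (intro ext) (simp only: sandwich_def S.star_def J_def[symmetric])
  have rank_J: "mat_rank J = r"
    unfolding J_def by (rule mat_rank_J_mat[OF assms(3)])
  have P: "P = S.P" and D: "D = (\<lambda>s. {X \<in> S.P. mat_rank X = s})"
    unfolding D_def P_def star M_def by simp_all
  show ?thesis
    unfolding D P star M_def
    using S.class_le_iff_rank_le_sandwiched S.class_le_iff_rank_le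
      S.regular_D_classes_eq S.class_less_iff rank_J by auto
qed

end
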